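(* Let $\Phi,\alpha,\beta:\mathbb{R}\to\mathbb{R}$ be given functions with $\alpha,\beta$ continuous, $\alpha>0$, and $\beta'=-\alpha\,\Phi'$. Consider the semidiscrete finite volume scheme for the one-dimensional Euler equations with gravity $$\frac{\mathrm{d}}{\mathrm{d}t}\overline{U}_j(t)=-\frac{1}{\Delta x}\left[\mathcal{F}\left(U^+_{j+1/2}(t),U^-_{j+1/2}(t)\right)-\mathcal{F}\left(U^+_{j-1/2}(t),U^-_{j-1/2}(t)\right)\right]+Q_j(t),\qquad j\in\mathbb{Z},$$ where $\mathcal{F}$ is any consistent numerical flux, the boundary extrapolated data $U^\pm_{j+1/2}$ are obtained from the cell averages $\overline{U}_j=(\overline{\rho}_j,\overline{m}_j,\overline{E}_j)$ by the well-balanced reconstruction described in the context, and $Q_j=(0,Q_j^{\rho v},Q_j^{E})$ with $$Q_j^{\rho v}=\frac12\left(\frac{\rho^+_{j-1/2}}{\alpha(x_{j-1/2})}+\frac{\rho^-_{j+1/2}}{\alpha(x_{j+1/2})}\right)\frac{\beta(x_{j+1/2})-\beta(x_{j-1/2})}{\Delta x},$$ $$Q_j^{E}=\frac12\left(\frac{m^+_{j-1/2}}{\alpha(x_{j-1/2})}+\frac{m^-_{j+1/2}}{\alpha(x_{j+1/2})}\right)\frac{\beta(x_{j+1/2})-\beta(x_{j-1/2})}{\Delta x}.$$ Then the scheme is exactly well balanced on the hydrostatic equilibrium solution $\rho(x,t)=\alpha(x)$, $v(x,t)=0$, $p(x,t)=\beta(x)$; that is, if the cell averages are those of this equilibrium,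 the right-hand side of the scheme is exactly zero for every $j$.
   Context: Equations: the one-dimensional Euler equations with gravity for an ideal gas with constant $\gamma>1$ are $\partial_t U+\partial_x f(U)=S$ with $U=(\rho,m,E)$, $m=\rho v$, $f(U)=(\rho v,\ \rho v^2+p,\ v(E+p))$, $p=(\gamma-1)\left(E-\tfrac12 m^2/\rho\right)$, $S=(0,-\rho\Phi',-\rho v\Phi')$. Grid: $\Delta x>0$, $x_j=j\Delta x$, $x_{j\pm1/2}=x_j\pm\Delta x/2$, $j\in\mathbb{Z}$; the $j$-th cell is $(x_{j-1/2},x_{j+1/2})$. An overbar with subscript $j$ denotes the cell average over the $j$-th cell, e.g. $\overline{\alpha}_j=\frac1{\Delta x}\int_{x_{j-1/2}}^{x_{j+1/2}}\alpha\,\mathrm{d}x$. Numerical flux: a function $\mathcal{F}(a,b)$ is consistent if $\mathcal{F}(U,U)=f(U)$ for all states $U$. Reconstruction: a (piecewise polynomial) reconstruction assigns to a sequence of cell averages $(\overline{g}_i)_{i\in\mathbb{Z}}$ a polynomial in each cell; it reproduces constants exactly, so in particular it maps zero cell averages to the zero polynomial in every cell. For a reconstructed quantity, $g^-_{j+1/2}$ denotes the value at $x_{j+1/2}$ of the polynomial of cell $j$ and $g^+_{j+1/2}$ the value at $x_{j+1/2}$ of the polynomial of cell $j+1$. Well-balanced reconstruction (first and second order scheme): from $\overline{U}_j$ set $\overline{p}_j=(\gamma-1)\left(\overline{E}_j-\tfrac12\overline{m}_j^2/\overline{\rho}_j\right)$, $\overline{r}_j=\overline{\rho}_j-\overline{\alpha}_j$,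 $\overline{\pi}_j=\overline{p}_j-\overline{\beta}_j$. Apply the reconstruction to $\overline{r}$, $\overline{\pi}$, $\overline{m}$ to obtain $r^\pm_{j+1/2},\pi^\pm_{j+1/2},m^\pm_{j+1/2}$. Then set $$\rho^\pm_{j+1/2}=r^\pm_{j+1/2}+\alpha(x_{j+1/2}),\quad p^\pm_{j+1/2}=\pi^\pm_{j+1/2}+\beta(x_{j+1/2}),\quad E^\pm_{j+1/2}=\frac12\frac{(m^\pm_{j+1/2})^2}{\rho^\pm_{j+1/2}}+\frac{p^\pm_{j+1/2}}{\gamma-1},$$ and $U^\pm_{j+1/2}=(\rho^\pm_{j+1/2},m^\pm_{j+1/2},E^\pm_{j+1/2})$. Equilibrium cell averages: $\overline{\rho}_j=\overline{\alpha}_j$, $\overline{m}_j=0$, $\overline{E}_j=\overline{\beta}_j/(\gamma-1)$ for all $j$. *)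

theory Defs
  imports "HOL-Analysis.Analysis" "HOL-Computational_Algebra.Polynomial"
begin

text \<open>States are triples \<open>(\<rho>, m, E)\<close> of density, momentum and total energy.\<close>

type_synonym state = "real \<times> real \<times> real"

fun dens :: "state \<Rightarrow> real" where "dens (\<rho>, m, E) = \<rho>"
fun mom :: "state \<Rightarrow> real" where "mom (\<rho>, m, E) = m"
fun ener :: "state \<Rightarrow> real" where "ener (\<rho>, m, E) = E"

definition pressure :: "real \<Rightarrow> state \<Rightarrow> real" where
  "pressure \<gamma> U = (\<gamma> - 1) * (ener U - 1/2 * (mom U)\<^sup>2 / dens U)"

definition euler_flux :: "real \<Rightarrow> state \<Rightarrow> state" where
  "euler_flux \<gamma> U =
     (let \<rho> = dens U; v = mom U / dens U; E = ener U; p = pressure \<gamma> U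
      in (\<rho> * v, \<rho> * v\<^sup>2 + p, v * (E + p)))"

text \<open>The flux is only meaningful for positive density, so consistency is required exactly there.
  Positivity of the pressure is not part of the notion of state, since the equilibrium pressure
  \<open>\<beta>\<close> is not assumed to be positive.\<close>

definition consistent_flux :: "real \<Rightarrow> (state \<Rightarrow> state \<Rightarrow> state) \<Rightarrow> bool" where
  "consistent_flux \<gamma> F \<longleftrightarrow> (\<forall>U. dens U > 0 \<longrightarrow> F U U = euler_flux \<gamma> U)"

text \<open>Interfaces are indexed by integers: index \<open>j\<close> stands for \<open>j + 1/2\<close>, so that cell \<open>j\<close> lies
  between the interfaces \<open>j - 1\<close> and \<open>j\<close>.\<close>

definition interface :: "real \<Rightarrow> int \<Rightarrow> real" where
  "interface dx j = of_int j * dx + dx / 2"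

definition cell_average :: "real \<Rightarrow> (real \<Rightarrow> real) \<Rightarrow> int \<Rightarrow> real" where
  "cell_average dx g j = 1 / dx * integral {interface dx (j - 1)..interface dx j} g"

text \<open>A reconstruction sends a sequence of cell averages to one polynomial, in the global
  coordinate \<open>x\<close>, for each cell.\<close>

type_synonym reconstruction = "(int \<Rightarrow> real) \<Rightarrow> int \<Rightarrow> real poly"

definition reproduces_constants :: "reconstruction \<Rightarrow> bool" where
  "reproduces_constants R \<longleftrightarrow> (\<forall>c j. R (\<lambda>_. c) j = [:c:])"

text \<open>The one-sided interface values \<open>g\<^sup>-\<close> and \<open>g\<^sup>+\<close> of the reconstruction at interface \<open>j\<close>.\<close>

definition trace_minus :: "reconstruction \<Rightarrow> real \<Rightarrow> (int \<Rightarrow> real) \<Rightarrow> int \<Rightarrow> real" where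
  "trace_minus R dx g j = poly (R g j) (interface dx j)"

definition trace_plus :: "reconstruction \<Rightarrow> real \<Rightarrow> (int \<Rightarrow> real) \<Rightarrow> int \<Rightarrow> real" where
  "trace_plus R dx g j = poly (R g (j + 1)) (interface dx j)"

text \<open>The well-balanced interface data, for a trace \<open>T\<close> that is \<^term>\<open>trace_minus R dx\<close> or
  \<^term>\<open>trace_plus R dx\<close>; \<open>W\<close> is the sequence of cell averages of the conserved variables.\<close>

definition wb_dens ::
  "((int \<Rightarrow> real) \<Rightarrow> int \<Rightarrow> real) \<Rightarrow> real \<Rightarrow> (real \<Rightarrow> real) \<Rightarrow> (int \<Rightarrow> state) \<Rightarrow> int \<Rightarrow> real" where
  "wb_dens T dx \<alpha> W j =
     T (\<lambda>i. dens (W i) - cell_average dx \<alpha> i) j + \<alpha> (interface dx j)"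

definition wb_mom ::
  "((int \<Rightarrow> real) \<Rightarrow> int \<Rightarrow> real) \<Rightarrow> (int \<Rightarrow> state) \<Rightarrow> int \<Rightarrow> real" where
  "wb_mom T W j = T (\<lambda>i. mom (W i)) j"

definition wb_pressure ::
  "((int \<Rightarrow> real) \<Rightarrow> int \<Rightarrow> real) \<Rightarrow> real \<Rightarrow> real \<Rightarrow> (real \<Rightarrow> real) \<Rightarrow> (int \<Rightarrow> state) \<Rightarrow> int \<Rightarrow> real" where
  "wb_pressure T \<gamma> dx \<beta> W j =
     T (\<lambda>i. pressure \<gamma> (W i) - cell_average dx \<beta> i) j + \<beta> (interface dx j)"

definition wb_state ::
  "((int \<Rightarrow> real) \<Rightarrow> int \<Rightarrow> real) \<Rightarrow> real \<Rightarrow> real \<Rightarrow> (real \<Rightarrow> real) \<Rightarrow> (real \<Rightarrow> real)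
     \<Rightarrow> (int \<Rightarrow> state) \<Rightarrow> int \<Rightarrow> state" where
  "wb_state T \<gamma> dx \<alpha> \<beta> W j =
     (let \<rho> = wb_dens T dx \<alpha> W j; m = wb_mom T W j; p = wb_pressure T \<gamma> dx \<beta> W j
      in (\<rho>, m, 1/2 * (m\<^sup>2 / \<rho>) + p / (\<gamma> - 1)))"

definition wb_source ::
  "reconstruction \<Rightarrow> real \<Rightarrow> (real \<Rightarrow> real) \<Rightarrow> (real \<Rightarrow> real) \<Rightarrow> (int \<Rightarrow> state) \<Rightarrow> int \<Rightarrow> state" where
  "wb_source R dx \<alpha> \<beta> W j =
     (let xl = interface dx (j - 1); xr = interface dx j; slope = (\<beta> xr - \<beta> xl) / dx
      in (0,
          1/2 * (wb_dens (trace_plus R dx) dx \<alpha> W (j - 1) / \<alpha> xl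
               + wb_dens (trace_minus R dx) dx \<alpha> W j / \<alpha> xr) * slope,
          1/2 * (wb_mom (trace_plus R dx) W (j - 1) / \<alpha> xl
               + wb_mom (trace_minus R dx) W j / \<alpha> xr) * slope))"

definition interface_flux ::
  "(state \<Rightarrow> state \<Rightarrow> state) \<Rightarrow> reconstruction \<Rightarrow> real \<Rightarrow> real \<Rightarrow> (real \<Rightarrow> real) \<Rightarrow> (real \<Rightarrow> real)
     \<Rightarrow> (int \<Rightarrow> state) \<Rightarrow> int \<Rightarrow> state" where
  "interface_flux F R \<gamma> dx \<alpha> \<beta> W j =
     F (wb_state (trace_plus R dx) \<gamma> dx \<alpha> \<beta> W j) (wb_state (trace_minus R dx) \<gamma> dx \<alpha> \<beta> W j)"

text \<open>The semidiscrete scheme is the system of ordinary differential equations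
  \<open>d/dt (W t j) = scheme_rhs F R \<gamma> dx \<alpha> \<beta> (W t) j\<close> for all integers \<open>j\<close>.\<close>

definition scheme_rhs ::
  "(state \<Rightarrow> state \<Rightarrow> state) \<Rightarrow> reconstruction \<Rightarrow> real \<Rightarrow> real \<Rightarrow> (real \<Rightarrow> real) \<Rightarrow> (real \<Rightarrow> real)
     \<Rightarrow> (int \<Rightarrow> state) \<Rightarrow> int \<Rightarrow> state" where
  "scheme_rhs F R \<gamma> dx \<alpha> \<beta> W j =
     - ((1 / dx) *\<^sub>R (interface_flux F R \<gamma> dx \<alpha> \<beta> W j - interface_flux F R \<gamma> dx \<alpha> \<beta> W (j - 1)))
     + wb_source R dx \<alpha> \<beta> W j"

definition equilibrium_averages ::
  "real \<Rightarrow> real \<Rightarrow> (real \<Rightarrow> real) \<Rightarrow> (real \<Rightarrow> real) \<Rightarrow> (int \<Rightarrow> state) \<Rightarrow> bool" where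
  "equilibrium_averages \<gamma> dx \<alpha> \<beta> W \<longleftrightarrow>
     (\<forall>j. dens (W j) = cell_average dx \<alpha> j \<and> mom (W j) = 0 \<and>
          ener (W j) = cell_average dx \<beta> j / (\<gamma> - 1))"

end

theory Submission
  imports Defs
begin

text \<open>At equilibrium the deviations \<open>r\<close>, \<open>\<pi>\<close> and the momentum have zero cell averages, so both
  interface states equal \<open>(\<alpha>, 0, \<beta> / (\<gamma> - 1))\<close>. By consistency the flux there is \<open>(0, \<beta>, 0)\<close>, and
  its difference quotient is exactly the momentum source, whose density ratios are both 1.\<close>

lemma trace_zero:
  assumes "reproduces_constants R"
  shows "trace_minus R dx (\<lambda>_. 0) j = 0" and "trace_plus R dx (\<lambda>_. 0) j = 0"
  using assms by (simp_all add: reproduces_constants_def trace_minus_def trace_plus_def)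

context
  fixes \<gamma> dx :: real and \<alpha> \<beta> :: "real \<Rightarrow> real" and W :: "int \<Rightarrow> state"
  assumes eq: "equilibrium_averages \<gamma> dx \<alpha> \<beta> W"
begin

lemma pressure_equilibrium:
  assumes "\<gamma> \<noteq> 1"
  shows "pressure \<gamma> (W i) = cell_average dx \<beta> i"
  using eq assms by (simp add: equilibrium_averages_def pressure_def)

text \<open>An abstract trace \<open>T\<close> that sends the zero sequence to zero covers both
  \<open>trace_minus\<close> and \<open>trace_plus\<close> with one argument.\<close>

lemma wb_dens_equilibrium:
  assumes "\<And>i. T (\<lambda>_. 0) i = 0"
  shows "wb_dens T dx \<alpha> W j = \<alpha> (interface dx j)"
  using eq assms by (simp add: equilibrium_averages_def wb_dens_def)

lemma wb_mom_equilibrium: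
  assumes "\<And>i. T (\<lambda>_. 0) i = 0"
  shows "wb_mom T W j = 0"
  using eq assms by (simp add: equilibrium_averages_def wb_mom_def)

lemma wb_state_equilibrium:
  assumes "\<gamma> \<noteq> 1" and "\<And>i. T (\<lambda>_. 0) i = 0"
  shows "wb_state T \<gamma> dx \<alpha> \<beta> W j = (\<alpha> (interface dx j), 0, \<beta> (interface dx j) / (\<gamma> - 1))"
  using assms
  by (simp add: wb_state_def wb_dens_equilibrium wb_mom_equilibrium wb_pressure_def
      pressure_equilibrium)

text \<open>Both arguments of \<open>F\<close> are the same state, and positivity of
  \<open>\<alpha>\<close> gives it the positive density that \<open>consistent_flux\<close> asks
  for.\<close>

lemma interface_flux_equilibrium:
  assumes "\<gamma> \<noteq> 1" and "\<And>x. \<alpha> x > 0"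
    and "consistent_flux \<gamma> F" and "reproduces_constants R"
  shows "interface_flux F R \<gamma> dx \<alpha> \<beta> W j = (0, \<beta> (interface dx j), 0)"
  using assms
  by (simp add: interface_flux_def wb_state_equilibrium trace_zero consistent_flux_def
      euler_flux_def pressure_def Let_def)

lemma wb_source_equilibrium:
  assumes "\<And>x. \<alpha> x > 0" and "reproduces_constants R"
  shows "wb_source R dx \<alpha> \<beta> W j
    = (0, (\<beta> (interface dx j) - \<beta> (interface dx (j - 1))) / dx, 0)"
  \<comment> \<open>Positivity is turned into \<open>\<alpha> x \<noteq> 0\<close>, so that both
    density ratios simplify to 1.\<close>
  using assms(2) assms(1)[THEN less_imp_neq, symmetric]
  by (simp add: wb_source_def wb_dens_equilibrium wb_mom_equilibrium trace_zero Let_def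
      diff_divide_distrib)

end

theorem theorem1:
  fixes \<Phi> \<alpha> \<beta> :: "real \<Rightarrow> real" and \<gamma> dx :: real
    and F :: "state \<Rightarrow> state \<Rightarrow> state" and R :: reconstruction
    and W :: "int \<Rightarrow> state"
  assumes "\<gamma> > 1" and "dx > 0"
    and "continuous_on UNIV \<alpha>" and "continuous_on UNIV \<beta>"
    and "\<And>x. \<alpha> x > 0"
    and "\<And>x. \<Phi> differentiable (at x)"
    and "\<And>x. (\<beta> has_real_derivative - (\<alpha> x * deriv \<Phi> x)) (at x)"
    and "consistent_flux \<gamma> F"
    and "reproduces_constants R"
    and "equilibrium_averages \<gamma> dx \<alpha> \<beta> W"
  shows "\<forall>j. scheme_rhs F R \<gamma> dx \<alpha> \<beta> W j = 0"
  using assms(1,5,8,9,10)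
  \<comment> \<open>\<open>zero_prod_def\<close> splits the zero state into components; in the
    momentum one the flux difference and the source cancel.\<close>
  by (simp add: scheme_rhs_def interface_flux_equilibrium wb_source_equilibrium zero_prod_def
      field_simps)

end
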